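(* Let $(X,\Sigma_X)$ be a measurable space, $p\ge 1$ an integer, $\mu$ a probability measure on $X$, and $Q,\overline{Q}:X\times\Sigma_X\to[0,1]$ Markov kernels. Define the Markov kernel $\mathcal{V}$ from $X$ to $X^p$ by $$\mathcal{V}(q_0,dq_1,\dots,dq_p)=\int_X\prod_{i=1}^p Q(q,dq_i)\,\overline{Q}(q_0,dq),$$ and let $\mathcal{M}$ be the probability measure on $X^{p+1}$ given by $\mathcal{M}(dq_0,dv)=\mathcal{V}(q_0,dv)\,\mu(dq_0)$, $v=(q_1,\dots,q_p)$. Let $S_0:=I$ and, for $j=1,\dots,p$, let $S_j:X^{p+1}\to X^{p+1}$ be given by $S_j(q_0,q_1,\dots,q_p)=(q_j,q_1,\dots,q_{j-1},q_0,q_{j+1},\dots,q_p)$. Suppose that $\mu\ll\mu_0$ for some $\sigma$-finite measure $\mu_0$ on $X$, with $\frac{d\mu}{d\mu_0}(q)>0$ for $\mu_0$-a.e. $q\in X$, and that $$Q(q,d\tilde q)\,\mu_0(dq)=\overline{Q}(\tilde q,dq)\,\mu_0(d\tilde q)$$ as measures on $X\times X$ (in the variables $(q,\tilde q)$). Then for every $j=0,1,\dots,p$, $S_j^*\mathcal{M}\ll\mathcal{M}$ and $$\frac{dS_j^*\mathcal{M}}{d\mathcal{M}}(q_0,v)=\frac{d\mu}{d\mu_0}(q_j)\Big(\frac{d\mu}{d\mu_0}(q_0)\Big)^{-1}\quad\text{for }\mathcal{M}\text{-a.e. }(q_0,v)=(q_0,q_1,\dots,q_p)\in X\times X^p.$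$
   Context: $X^p$ and $X^{p+1}$ carry the product $\sigma$-algebras. A Markov kernel $Q:X\times\Sigma_X\to[0,1]$ is a map such that $Q(q,\cdot)$ is a probability measure for each $q$ and $q\mapsto Q(q,E)$ is measurable for each $E\in\Sigma_X$. $\phi^*\nu$ denotes the pushforward of the measure $\nu$ by $\phi$: $\phi^*\nu(E)=\nu(\phi^{-1}(E))$. $d\nu/d\rho$ denotes the Radon–Nikodym derivative. *)

theory Defs
  imports "HOL-Probability.Probability"
begin

text \<open>
  A Markov kernel on \<open>X\<close> is rendered as a measurable map into the Giry monad,
  \<open>Q \<in> X \<rightarrow>\<^sub>M prob_algebra X\<close>. The following lemma confirms that this is the elementary notion.
\<close>

lemma markov_kernel_iff:
  "Q \<in> X \<rightarrow>\<^sub>M prob_algebra Y \<longleftrightarrow>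
     (\<forall>q\<in>space X. prob_space (Q q) \<and> sets (Q q) = sets Y) \<and>
     (\<forall>E\<in>sets Y. (\<lambda>q. emeasure (Q q) E) \<in> borel_measurable X)"
proof (intro iffI conjI ballI)
  assume Q: "Q \<in> X \<rightarrow>\<^sub>M prob_algebra Y"
  show "prob_space (Q q)" "sets (Q q) = sets Y" if "q \<in> space X" for q
    using measurable_space[OF Q that] by (auto simp: space_prob_algebra)
  show "(\<lambda>q. emeasure (Q q) E) \<in> borel_measurable X" if "E \<in> sets Y" for E
    using measurable_emeasure_kernel[OF measurable_prob_algebraD[OF Q] that] .
next
  assume "(\<forall>q\<in>space X. prob_space (Q q) \<and> sets (Q q) = sets Y) \<and>
    (\<forall>E\<in>sets Y. (\<lambda>q. emeasure (Q q) E) \<in> borel_measurable X)"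
  then show "Q \<in> X \<rightarrow>\<^sub>M prob_algebra Y"
    by (intro measurable_prob_algebraI measurable_subprob_algebra)
       (auto intro: prob_space_imp_subprob_space)
qed

text \<open>
  Points of \<open>X\<^sup>p\<close> are extensional functions on \<open>{1..p}\<close>, points of \<open>X\<^sup>p\<^sup>+\<^sup>1\<close> are extensional
  functions on \<open>{0..p}\<close>; the pair \<open>(q\<^sub>0, v)\<close> corresponds to \<open>v(0 := q\<^sub>0)\<close>.
\<close>

definition proposal_kernel ::
  "('a \<Rightarrow> 'a measure) \<Rightarrow> ('a \<Rightarrow> 'a measure) \<Rightarrow> nat \<Rightarrow> 'a \<Rightarrow> (nat \<Rightarrow> 'a) measure" where
  "proposal_kernel Q Qbar p q0 = Qbar q0 \<bind> (\<lambda>q. \<Pi>\<^sub>M i\<in>{1..p}. Q q)"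

definition target_proposal_measure ::
  "'a measure \<Rightarrow> 'a measure \<Rightarrow> ('a \<Rightarrow> 'a measure) \<Rightarrow> ('a \<Rightarrow> 'a measure) \<Rightarrow> nat \<Rightarrow>
   (nat \<Rightarrow> 'a) measure" where
  "target_proposal_measure X \<mu> Q Qbar p =
     \<mu> \<bind> (\<lambda>q0. distr (proposal_kernel Q Qbar p q0) (\<Pi>\<^sub>M i\<in>{0..p}. X) (\<lambda>v. v(0 := q0)))"

text \<open>For \<open>j = 0\<close> this is the identity.\<close>

definition coord_swap :: "nat \<Rightarrow> (nat \<Rightarrow> 'a) \<Rightarrow> (nat \<Rightarrow> 'a)" where
  "coord_swap j q = q(0 := q j, j := q 0)"

lemma coord_swap_0: "coord_swap 0 = id"
  by (auto simp: coord_swap_def fun_eq_iff)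

text \<open>
  The monadic bind only has its intended meaning for measurable kernels. The lemmas below
  check that this is the case here, and give the integral formulas for the two measures.
\<close>

lemma PiM_kernel_measurable:
  assumes Q: "Q \<in> X \<rightarrow>\<^sub>M prob_algebra X" and I: "finite (I :: nat set)"
  shows "(\<lambda>q. \<Pi>\<^sub>M i\<in>I. Q q) \<in> X \<rightarrow>\<^sub>M prob_algebra (\<Pi>\<^sub>M i\<in>I. X)"
proof (rule measurable_prob_algebra_generated[OF sets_PiM Int_stable_prod_algebra prod_algebra_sets_into_space])
  have Qs: "prob_space (Q q)" "sets (Q q) = sets X" if "q \<in> space X" for q
    using measurable_space[OF Q that] by (auto simp: space_prob_algebra)
  show "prob_space (\<Pi>\<^sub>M i\<in>I. Q q)" if "q \<in> space X" for q
    by (rule prob_space_PiM) (use Qs that in auto)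
  show "sets (\<Pi>\<^sub>M i\<in>I. Q q) = sets (\<Pi>\<^sub>M i\<in>I. X)" if "q \<in> space X" for q
    by (rule sets_PiM_cong) (use Qs that in auto)
  fix A assume "A \<in> prod_algebra I (\<lambda>_. X)"
  then obtain E where A: "A = Pi\<^sub>E I E" and E: "\<And>i. i \<in> I \<Longrightarrow> E i \<in> sets X"
    by (auto simp: prod_algebra_eq_finite[OF I])
  have "emeasure (\<Pi>\<^sub>M i\<in>I. Q q) A = (\<Prod>i\<in>I. emeasure (Q q) (E i))" if "q \<in> space X" for q
  proof -
    interpret prob_space "Q q" by (rule Qs(1)[OF that])
    interpret product_sigma_finite "\<lambda>_. Q q" by unfold_locales
    show ?thesis unfolding A by (rule emeasure_PiM[OF I]) (use E Qs that in auto)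
  qed
  moreover have "(\<lambda>q. \<Prod>i\<in>I. emeasure (Q q) (E i)) \<in> borel_measurable X"
    by (intro borel_measurable_prod_ennreal measurable_emeasure_kernel[OF measurable_prob_algebraD[OF Q]] E)
  ultimately show "(\<lambda>q. emeasure (\<Pi>\<^sub>M i\<in>I. Q q) A) \<in> borel_measurable X"
    by (subst measurable_cong) auto
qed

lemma proposal_kernel_measurable:
  assumes "Q \<in> X \<rightarrow>\<^sub>M prob_algebra X" "Qbar \<in> X \<rightarrow>\<^sub>M prob_algebra X"
  shows "proposal_kernel Q Qbar p \<in> X \<rightarrow>\<^sub>M prob_algebra (\<Pi>\<^sub>M i\<in>{1..p}. X)"
  unfolding proposal_kernel_def
  by (rule measurable_bind_prob_space[OF assms(2) PiM_kernel_measurable[OF assms(1)]]) simp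

lemma emeasure_proposal_kernel:
  assumes Q: "Q \<in> X \<rightarrow>\<^sub>M prob_algebra X" and Qbar: "Qbar \<in> X \<rightarrow>\<^sub>M prob_algebra X"
    and q0: "q0 \<in> space X" and E: "\<And>i. i \<in> {1..p} \<Longrightarrow> E i \<in> sets X"
  shows "emeasure (proposal_kernel Q Qbar p q0) (Pi\<^sub>E {1..p} E) =
     (\<integral>\<^sup>+q. (\<Prod>i=1..p. emeasure (Q q) (E i)) \<partial>Qbar q0)"
proof -
  have Qb: "Qbar q0 \<in> space (prob_algebra X)"
    by (rule measurable_space[OF Qbar q0])
  then have [simp]: "space (Qbar q0) = space X"
    by (auto simp: space_prob_algebra dest: sets_eq_imp_space_eq)
  have "emeasure (proposal_kernel Q Qbar p q0) (Pi\<^sub>E {1..p} E) =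
     (\<integral>\<^sup>+q. emeasure (\<Pi>\<^sub>M i\<in>{1..p}. Q q) (Pi\<^sub>E {1..p} E) \<partial>Qbar q0)"
    unfolding proposal_kernel_def
    by (rule emeasure_bind_prob_algebra[OF Qb PiM_kernel_measurable[OF Q]])
       (use E in \<open>auto intro: sets_PiM_I_finite\<close>)
  also have "\<dots> = (\<integral>\<^sup>+q. (\<Prod>i=1..p. emeasure (Q q) (E i)) \<partial>Qbar q0)"
  proof (rule nn_integral_cong)
    fix q assume "q \<in> space (Qbar q0)"
    then have Qq: "prob_space (Q q)" "sets (Q q) = sets X"
      using measurable_space[OF Q, of q] by (auto simp: space_prob_algebra)
    interpret prob_space "Q q" by (rule Qq(1))
    interpret product_sigma_finite "\<lambda>_. Q q" by unfold_locales
    show "emeasure (\<Pi>\<^sub>M i\<in>{1..p}. Q q) (Pi\<^sub>E {1..p} E) = (\<Prod>i=1..p. emeasure (Q q) (E i))"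
      by (rule emeasure_PiM) (use E Qq in auto)
  qed
  finally show ?thesis .
qed

lemma insert_coord_measurable:
  "(\<lambda>(q0, v). v(0 := q0)) \<in> X \<Otimes>\<^sub>M (\<Pi>\<^sub>M i\<in>{1..p}. X) \<rightarrow>\<^sub>M (\<Pi>\<^sub>M i\<in>{0..p::nat}. X)"
proof -
  have "{0..p} = insert 0 {1..p}" by auto
  then have "(\<lambda>w. (snd w)(0 := fst w)) \<in>
      X \<Otimes>\<^sub>M (\<Pi>\<^sub>M i\<in>{1..p}. X) \<rightarrow>\<^sub>M (\<Pi>\<^sub>M i\<in>{0..p}. X)"
    by (simp only:) (rule measurable_fun_upd[of _ "{1..p}"], auto)
  then show ?thesis by (simp add: case_prod_beta)
qed

lemma coord_swap_measurable:
  assumes "j \<le> p"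
  shows "coord_swap j \<in> (\<Pi>\<^sub>M i\<in>{0..p}. X) \<rightarrow>\<^sub>M (\<Pi>\<^sub>M i\<in>{0..p}. X)"
  unfolding coord_swap_def
  by (rule measurable_fun_upd[of _ "{0..p}"], use assms in auto,
      rule measurable_fun_upd[of _ "{0..p}"], use assms in auto)

lemma target_kernel_measurable:
  assumes "Q \<in> X \<rightarrow>\<^sub>M prob_algebra X" "Qbar \<in> X \<rightarrow>\<^sub>M prob_algebra X"
  shows "(\<lambda>q0. distr (proposal_kernel Q Qbar p q0) (\<Pi>\<^sub>M i\<in>{0..p}. X) (\<lambda>v. v(0 := q0)))
     \<in> X \<rightarrow>\<^sub>M prob_algebra (\<Pi>\<^sub>M i\<in>{0..p}. X)"
  by (rule measurable_distr_prob_space2[OF proposal_kernel_measurable[OF assms] insert_coord_measurable])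

lemma target_proposal_measure_in_prob_algebra:
  assumes "prob_space \<mu>" "sets \<mu> = sets X"
    and "Q \<in> X \<rightarrow>\<^sub>M prob_algebra X" "Qbar \<in> X \<rightarrow>\<^sub>M prob_algebra X"
  shows "target_proposal_measure X \<mu> Q Qbar p \<in> space (prob_algebra (\<Pi>\<^sub>M i\<in>{0..p}. X))"
  unfolding target_proposal_measure_def
  using prob_space_bind'[OF _ target_kernel_measurable[OF assms(3,4), of p], of \<mu>]
    sets_bind'[OF _ target_kernel_measurable[OF assms(3,4), of p], of \<mu>] assms(1,2)
  by (auto simp: space_prob_algebra)

lemma emeasure_target_proposal_measure:
  assumes \<mu>: "prob_space \<mu>" "sets \<mu> = sets X"
    and Q: "Q \<in> X \<rightarrow>\<^sub>M prob_algebra X" "Qbar \<in> X \<rightarrow>\<^sub>M prob_algebra X"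
    and A: "A \<in> sets (\<Pi>\<^sub>M i\<in>{0..p}. X)"
  shows "emeasure (target_proposal_measure X \<mu> Q Qbar p) A =
     (\<integral>\<^sup>+q0. (\<integral>\<^sup>+v. indicator A (v(0 := q0)) \<partial>proposal_kernel Q Qbar p q0) \<partial>\<mu>)"
proof -
  have \<mu>': "\<mu> \<in> space (prob_algebra X)" using \<mu> by (simp add: space_prob_algebra)
  have "emeasure (target_proposal_measure X \<mu> Q Qbar p) A =
     (\<integral>\<^sup>+q0. emeasure (distr (proposal_kernel Q Qbar p q0) (\<Pi>\<^sub>M i\<in>{0..p}. X) (\<lambda>v. v(0 := q0))) A \<partial>\<mu>)"
    unfolding target_proposal_measure_def
    by (rule emeasure_bind_prob_algebra[OF \<mu>' target_kernel_measurable[OF Q] A])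
  also have "\<dots> = (\<integral>\<^sup>+q0. (\<integral>\<^sup>+v. indicator A (v(0 := q0)) \<partial>proposal_kernel Q Qbar p q0) \<partial>\<mu>)"
  proof (rule nn_integral_cong)
    fix q0 assume "q0 \<in> space \<mu>"
    then have q0: "q0 \<in> space X" using sets_eq_imp_space_eq[OF \<mu>(2)] by simp
    have s: "sets (proposal_kernel Q Qbar p q0) = sets (\<Pi>\<^sub>M i\<in>{1..p}. X)"
      using measurable_space[OF proposal_kernel_measurable[OF Q] q0] by (simp add: space_prob_algebra)
    have "(\<lambda>v. v(0 := q0)) \<in> (\<Pi>\<^sub>M i\<in>{1..p}. X) \<rightarrow>\<^sub>M (\<Pi>\<^sub>M i\<in>{0..p}. X)"
      using measurable_Pair2[OF insert_coord_measurable q0] by simp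
    then have m: "(\<lambda>v. v(0 := q0)) \<in> proposal_kernel Q Qbar p q0 \<rightarrow>\<^sub>M (\<Pi>\<^sub>M i\<in>{0..p}. X)"
      by (simp cong: measurable_cong_sets add: measurable_cong_sets[OF s refl])
    show "emeasure (distr (proposal_kernel Q Qbar p q0) (\<Pi>\<^sub>M i\<in>{0..p}. X) (\<lambda>v. v(0 := q0))) A =
       (\<integral>\<^sup>+v. indicator A (v(0 := q0)) \<partial>proposal_kernel Q Qbar p q0)"
      using nn_integral_distr[OF m, of "indicator A"] A by simp
  qed
  finally show ?thesis .
qed

end

theory Submission
  imports Defs
begin

text \<open>
  Put \<open>M\<^sub>0(dw) = \<integral> \<Prod>\<^bsub>i=0\<^esub>\<^bsup>p\<^esup> Q(q, dw\<^sub>i) \<mu>\<^sub>0(dq)\<close>. By the reversibility relation between \<open>Q\<close> and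
  \<open>Qbar\<close>, the measure \<open>M\<close> has density \<open>w \<mapsto> f(w\<^sub>0)\<close> with respect to \<open>M\<^sub>0\<close>, where \<open>f = d\<mu>/d\<mu>\<^sub>0\<close>.
  As \<open>M\<^sub>0\<close> is invariant under coordinate swaps, the pushforward of \<open>M\<close> under the \<open>j\<close>-th swap has
  density \<open>w \<mapsto> f(w\<^sub>j)\<close> with respect to \<open>M\<^sub>0\<close>. Every one-dimensional marginal of \<open>M\<^sub>0\<close> is \<open>\<mu>\<^sub>0\<close>, so
  \<open>0 < f(w\<^sub>0) < \<infinity>\<close> holds \<open>M\<^sub>0\<close>-almost everywhere and the two densities can be divided.
\<close>

section \<open>Integration against kernels, and consequences of reversibility\<close>

lemma prob_algebra_kernelD:
  assumes "K \<in> X \<rightarrow>\<^sub>M prob_algebra Y" "q \<in> space X"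
  shows "prob_space (K q)" "sets (K q) = sets Y" "space (K q) = space Y"
  using measurable_space[OF assms] by (auto simp: space_prob_algebra dest: sets_eq_imp_space_eq)

lemma kernel_pair_measurable:
  assumes "K \<in> X \<rightarrow>\<^sub>M prob_algebra Y" "(\<lambda>(x, y). g x y) \<in> X \<Otimes>\<^sub>M Y \<rightarrow>\<^sub>M N"
  shows "(\<lambda>x. distr (K x) N (g x)) \<in> X \<rightarrow>\<^sub>M subprob_algebra N"
  by (rule measurable_prob_algebraD[OF measurable_distr_prob_space2[OF assms]])

text \<open>Both joint laws in the reversibility relation are mixtures of pushforwards of this form,
  so this turns integrals against them into iterated integrals.\<close>

lemma nn_integral_bind_distr:
  assumes K: "K \<in> X \<rightarrow>\<^sub>M prob_algebra Y" and sets: "sets m = sets X"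
    and g: "(\<lambda>(x, y). g x y) \<in> X \<Otimes>\<^sub>M Y \<rightarrow>\<^sub>M N" and h: "h \<in> borel_measurable N"
  shows "(\<integral>\<^sup>+z. h z \<partial>(m \<bind> (\<lambda>x. distr (K x) N (g x)))) = (\<integral>\<^sup>+x. \<integral>\<^sup>+y. h (g x y) \<partial>K x \<partial>m)"
proof -
  have "(\<lambda>x. distr (K x) N (g x)) \<in> m \<rightarrow>\<^sub>M subprob_algebra N"
    using kernel_pair_measurable[OF K g] by (simp add: measurable_cong_sets[OF sets refl])
  then have "(\<integral>\<^sup>+z. h z \<partial>(m \<bind> (\<lambda>x. distr (K x) N (g x)))) = (\<integral>\<^sup>+x. \<integral>\<^sup>+z. h z \<partial>distr (K x) N (g x) \<partial>m)"
    by (rule nn_integral_bind[OF h])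
  also have "\<dots> = (\<integral>\<^sup>+x. \<integral>\<^sup>+y. h (g x y) \<partial>K x \<partial>m)"
  proof (rule nn_integral_cong)
    fix x assume "x \<in> space m"
    then have x: "x \<in> space X" using sets_eq_imp_space_eq[OF sets] by simp
    have "g x \<in> K x \<rightarrow>\<^sub>M N"
      using measurable_Pair2[OF g x] by (simp add: measurable_cong_sets[OF prob_algebra_kernelD(2)[OF K x] refl])
    then show "(\<integral>\<^sup>+z. h z \<partial>distr (K x) N (g x)) = (\<integral>\<^sup>+y. h (g x y) \<partial>K x)"
      using h by (simp add: nn_integral_distr)
  qed
  finally show ?thesis .
qed

text \<open>Integrating one test function against the two sides of \<open>rev\<close> gives the
  exchange of kernels in the form in which it is applied later.\<close>

lemma reversible_nn_integral:
  assumes Q: "Q \<in> X \<rightarrow>\<^sub>M prob_algebra X" and Qbar: "Qbar \<in> X \<rightarrow>\<^sub>M prob_algebra X"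
    and sets: "sets m = sets X"
    and rev: "m \<bind> (\<lambda>q. distr (Q q) (X \<Otimes>\<^sub>M X) (\<lambda>q'. (q, q'))) =
         m \<bind> (\<lambda>q'. distr (Qbar q') (X \<Otimes>\<^sub>M X) (\<lambda>q. (q, q')))"
    and h: "(\<lambda>(q, q'). h q q') \<in> borel_measurable (X \<Otimes>\<^sub>M X)"
  shows "(\<integral>\<^sup>+q. \<integral>\<^sup>+q'. h q q' \<partial>Q q \<partial>m) = (\<integral>\<^sup>+q'. \<integral>\<^sup>+q. h q q' \<partial>Qbar q' \<partial>m)"
  using arg_cong[OF rev, of "\<lambda>M. \<integral>\<^sup>+z. (\<lambda>(q, q'). h q q') z \<partial>M"]
    nn_integral_bind_distr[OF Q sets, of "\<lambda>q q'. (q, q')", OF _ h]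
    nn_integral_bind_distr[OF Qbar sets, of "\<lambda>q' q. (q, q')", OF _ h]
  by simp

text \<open>Stationarity follows from reversibility by testing with functions of the second variable
  alone. It later identifies the one-dimensional marginals of the mixture.\<close>

lemma reversible_bind_eq:
  assumes Q: "Q \<in> X \<rightarrow>\<^sub>M prob_algebra X" and Qbar: "Qbar \<in> X \<rightarrow>\<^sub>M prob_algebra X"
    and sets: "sets m = sets X" and ne: "space X \<noteq> {}"
    and rev: "m \<bind> (\<lambda>q. distr (Q q) (X \<Otimes>\<^sub>M X) (\<lambda>q'. (q, q'))) =
         m \<bind> (\<lambda>q'. distr (Qbar q') (X \<Otimes>\<^sub>M X) (\<lambda>q. (q, q')))"
  shows "m \<bind> Q = m"
proof (rule measure_eqI)
  have Qm: "Q \<in> m \<rightarrow>\<^sub>M subprob_algebra X"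
    using measurable_prob_algebraD[OF Q] by (simp add: measurable_cong_sets[OF sets refl])
  have sp: "space m = space X" by (rule sets_eq_imp_space_eq[OF sets])
  show "sets (m \<bind> Q) = sets m"
    using sets_bind[of m Q X] prob_algebra_kernelD(2)[OF Q] ne sp sets by auto
  then have sets_b: "sets (m \<bind> Q) = sets X" using sets by simp
  fix E assume "E \<in> sets (m \<bind> Q)"
  then have E: "E \<in> sets X" using sets_b by simp
  have "emeasure (m \<bind> Q) E = (\<integral>\<^sup>+q. \<integral>\<^sup>+q'. indicator E q' \<partial>Q q \<partial>m)"
    using nn_integral_bind[OF borel_measurable_indicator[OF E] Qm] E sets_b by simp
  also have "\<dots> = (\<integral>\<^sup>+q'. \<integral>\<^sup>+q. indicator E q' \<partial>Qbar q' \<partial>m)"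
    using measurable_compose[OF measurable_snd borel_measurable_indicator[OF E]]
    by (intro reversible_nn_integral[OF Q Qbar sets rev]) (simp add: case_prod_beta')
  \<comment> \<open>The integrand is constant in \<open>q\<close>, and \<open>Qbar q'\<close> has
    total mass one.\<close>
  also have "\<dots> = (\<integral>\<^sup>+q'. indicator E q' \<partial>m)"
    by (rule nn_integral_cong)
       (simp add: sp prob_space.emeasure_space_1[OF prob_algebra_kernelD(1)[OF Qbar]])
  also have "\<dots> = emeasure m E" using E sets by simp
  finally show "emeasure (m \<bind> Q) E = emeasure m E" .
qed

section \<open>The exchangeable reference measure\<close>

text \<open>This is the measure called \<open>M\<^sub>0\<close> in the overview: given the latent
  point \<open>q\<close>, all coordinates, including the one with index 0, are independent with law
  \<open>Q q\<close>. It is infinite when \<open>m\<close> is.\<close>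

definition mixed_product_measure ::
  "'a measure \<Rightarrow> ('a \<Rightarrow> 'a measure) \<Rightarrow> nat \<Rightarrow> (nat \<Rightarrow> 'a) measure" where
  "mixed_product_measure m Q p = m \<bind> (\<lambda>q. \<Pi>\<^sub>M i\<in>{0..p}. Q q)"

text \<open>The factors are identical, so reindexing by the transposition \<open>?t\<close> of 0 and
  \<open>j\<close> preserves the product.\<close>

lemma distr_PiM_coord_swap:
  assumes "prob_space N" "j \<le> p"
  shows "distr (\<Pi>\<^sub>M i\<in>{0..p}. N) (\<Pi>\<^sub>M i\<in>{0..p}. N) (coord_swap j) = (\<Pi>\<^sub>M i\<in>{0..p}. N)"
proof -
  let ?t = "\<lambda>n. if n = 0 then j else if n = j then 0 else n"
  have "distr (\<Pi>\<^sub>M i\<in>{0..p}. N) (\<Pi>\<^sub>M i\<in>{0..p}. N) (coord_swap j) =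
      distr (\<Pi>\<^sub>M i\<in>{0..p}. N) (\<Pi>\<^sub>M i\<in>{0..p}. N) (\<lambda>w. \<lambda>n\<in>{0..p}. w (?t n))"
  proof (rule distr_cong[OF refl refl])
    fix w assume "w \<in> space (\<Pi>\<^sub>M i\<in>{0..p}. N)"
    \<comment> \<open>Off the index set the restricted function is \<open>undefined\<close>. The
      swap agrees there because it alters only the indices 0 and \<open>j\<close>, both at most
      \<open>p\<close>.\<close>
    then have "w n = undefined" if "n \<notin> {0..p}" for n
      using that by (auto simp: space_PiM PiE_def extensional_def)
    then show "coord_swap j w = (\<lambda>n\<in>{0..p}. w (?t n))"
      using assms(2) by (auto simp: coord_swap_def fun_eq_iff)
  qed
  also have "\<dots> = (\<Pi>\<^sub>M i\<in>{0..p}. N)"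
    by (rule distr_PiM_reindex) (use assms in \<open>auto simp: inj_on_def split: if_splits\<close>)
  finally show ?thesis .
qed

context
  fixes X m :: "'a measure" and Q :: "'a \<Rightarrow> 'a measure" and p :: nat
  assumes Q: "Q \<in> X \<rightarrow>\<^sub>M prob_algebra X" and sets_m: "sets m = sets X" and ne: "space X \<noteq> {}"
begin

lemma PiM_kernel_subprob:
  "(\<lambda>q. \<Pi>\<^sub>M i\<in>{0..p}. Q q) \<in> m \<rightarrow>\<^sub>M subprob_algebra (\<Pi>\<^sub>M i\<in>{0..p}. X)"
  using measurable_prob_algebraD[OF PiM_kernel_measurable[OF Q, of "{0..p}"]]
  by (simp add: measurable_cong_sets[OF sets_m refl])

lemma space_base: "space m = space X"
  by (rule sets_eq_imp_space_eq[OF sets_m])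

lemma sets_PiM_kernel:
  assumes "q \<in> space X"
  shows "sets (\<Pi>\<^sub>M i\<in>I. Q q) = sets (\<Pi>\<^sub>M i\<in>I. X)"
  by (rule sets_PiM_cong) (simp_all add: prob_algebra_kernelD(2)[OF Q assms])

lemma sets_mixed_product_measure:
  "sets (mixed_product_measure m Q p) = sets (\<Pi>\<^sub>M i\<in>{0..p}. X)"
  unfolding mixed_product_measure_def
  by (rule sets_bind) (use sets_PiM_kernel space_base ne in auto)

lemma distr_mixed_product_measure:
  assumes "g \<in> (\<Pi>\<^sub>M i\<in>{0..p}. X) \<rightarrow>\<^sub>M N"
  shows "distr (mixed_product_measure m Q p) N g = m \<bind> (\<lambda>q. distr (\<Pi>\<^sub>M i\<in>{0..p}. Q q) N g)"
  unfolding mixed_product_measure_def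
  by (rule distr_bind[OF PiM_kernel_subprob _ assms]) (simp add: space_base ne)

text \<open>The pushforward passes under the mixture, and each product measure in it is already
  invariant.\<close>

lemma mixed_product_measure_coord_swap:
  assumes "j \<le> p"
  shows "distr (mixed_product_measure m Q p) (\<Pi>\<^sub>M i\<in>{0..p}. X) (coord_swap j) =
    mixed_product_measure m Q p"
  unfolding distr_mixed_product_measure[OF coord_swap_measurable[OF assms]]
  unfolding mixed_product_measure_def
proof (rule bind_cong[OF refl])
  fix q assume "q \<in> space m"
  then have q: "q \<in> space X" by (simp add: space_base)
  show "distr (\<Pi>\<^sub>M i\<in>{0..p}. Q q) (\<Pi>\<^sub>M i\<in>{0..p}. X) (coord_swap j) = (\<Pi>\<^sub>M i\<in>{0..p}. Q q)"
    using distr_PiM_coord_swap[OF prob_algebra_kernelD(1)[OF Q q] assms]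
    by (simp add: distr_cong[OF refl sets_PiM_kernel[OF q, symmetric] refl])
qed

lemma mixed_product_measure_component:
  assumes "i \<le> p"
  shows "distr (mixed_product_measure m Q p) X (\<lambda>w. w i) = m \<bind> Q"
proof -
  have "(\<lambda>w. w i) \<in> (\<Pi>\<^sub>M i\<in>{0..p}. X) \<rightarrow>\<^sub>M X"
    using assms by (intro measurable_component_singleton) simp
  moreover have "distr (\<Pi>\<^sub>M i\<in>{0..p}. Q q) X (\<lambda>w. w i) = Q q" if "q \<in> space m" for q
  proof -
    have q: "q \<in> space X" using that by (simp add: space_base)
    show ?thesis
      using distr_PiM_component[of "{0..p}" "\<lambda>_. Q q" i] prob_algebra_kernelD[OF Q q] assms
      by (simp add: distr_cong[OF refl prob_algebra_kernelD(2)[OF Q q, symmetric] refl])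
  qed
  ultimately show ?thesis
    by (simp add: distr_mixed_product_measure cong: bind_cong_simp)
qed

text \<open>Reversibility trades \<open>Qbar q0\<close> integrated over \<open>q0\<close> for
  \<open>Q q\<close> integrated over \<open>q\<close>. The current state then becomes one more
  independent draw from \<open>Q q\<close>, which completes the product over \<open>{1..p}\<close>
  to one over \<open>{0..p}\<close>. The weight \<open>f q0\<close> is carried along as the
  density.\<close>

lemma target_proposal_measure_density:
  assumes Qbar: "Qbar \<in> X \<rightarrow>\<^sub>M prob_algebra X"
    and rev: "m \<bind> (\<lambda>q. distr (Q q) (X \<Otimes>\<^sub>M X) (\<lambda>q'. (q, q'))) =
         m \<bind> (\<lambda>q'. distr (Qbar q') (X \<Otimes>\<^sub>M X) (\<lambda>q. (q, q')))"
    and f: "f \<in> borel_measurable X" and prob: "prob_space (density m f)"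
  shows "target_proposal_measure X (density m f) Q Qbar p =
    density (mixed_product_measure m Q p) (\<lambda>w. f (w 0))"
    (is "?M = density ?N _")
proof (rule measure_eqI)
  let ?P = "\<Pi>\<^sub>M i\<in>{0..p}. X" and ?V = "\<lambda>q. \<Pi>\<^sub>M i\<in>{1..p}. Q q"
  have sets_M: "sets ?M = sets ?P"
    using target_proposal_measure_in_prob_algebra[OF prob _ Q Qbar, of p] sets_m
    by (simp add: space_prob_algebra)
  show "sets ?M = sets (density ?N (\<lambda>w. f (w 0)))"
    using sets_M sets_mixed_product_measure by simp
  fix A assume "A \<in> sets ?M"
  then have A: "A \<in> sets ?P" using sets_M by simp
  have V: "?V \<in> X \<rightarrow>\<^sub>M prob_algebra (\<Pi>\<^sub>M i\<in>{1..p}. X)"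
    by (rule PiM_kernel_measurable[OF Q]) simp
  have ins: "(\<lambda>v. v(0 := q0)) \<in> (\<Pi>\<^sub>M i\<in>{1..p}. X) \<rightarrow>\<^sub>M ?P" if "q0 \<in> space X" for q0
    using measurable_Pair2[OF insert_coord_measurable that] by simp
  \<comment> \<open>The next steps lead to \<open>G\<close>, the joint measurability in
    \<open>q\<close> and \<open>q0\<close> of the inner integral, which the exchange by
    reversibility requires.\<close>
  have "(\<lambda>((q, q0), v). v(0 := q0)) \<in> (X \<Otimes>\<^sub>M X) \<Otimes>\<^sub>M (\<Pi>\<^sub>M i\<in>{1..p}. X) \<rightarrow>\<^sub>M ?P"
    using measurable_compose[OF _ insert_coord_measurable,
        of "\<lambda>((q, q0), v). (q0, v)" "(X \<Otimes>\<^sub>M X) \<Otimes>\<^sub>M (\<Pi>\<^sub>M i\<in>{1..p}. X)" X p]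
    by (simp add: case_prod_beta')
  from measurable_compose[OF this borel_measurable_indicator[OF A]]
  have "(\<lambda>(qq, v). indicator A (v(0 := snd qq)) :: ennreal) \<in>
      borel_measurable ((X \<Otimes>\<^sub>M X) \<Otimes>\<^sub>M (\<Pi>\<^sub>M i\<in>{1..p}. X))"
    by (simp add: case_prod_beta')
  moreover have "(\<lambda>qq. ?V (fst qq)) \<in> X \<Otimes>\<^sub>M X \<rightarrow>\<^sub>M subprob_algebra (\<Pi>\<^sub>M i\<in>{1..p}. X)"
    by (rule measurable_compose[OF measurable_fst measurable_prob_algebraD[OF V]])
  ultimately have "(\<lambda>qq. \<integral>\<^sup>+v. indicator A (v(0 := snd qq)) \<partial>?V (fst qq)) \<in> borel_measurable (X \<Otimes>\<^sub>M X)"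
    by (rule nn_integral_measurable_subprob_algebra2)
  then have G: "(\<lambda>(q, q0). \<integral>\<^sup>+v. indicator A (v(0 := q0)) \<partial>?V q) \<in> borel_measurable (X \<Otimes>\<^sub>M X)"
    by (simp add: case_prod_beta')
  have f0: "(\<lambda>w. f (w 0)) \<in> borel_measurable ?P"
    using f by measurable
  have fA: "(\<lambda>w. f (w 0) * indicator A w) \<in> borel_measurable ?P"
    using f0 A by measurable
  have "emeasure ?M A =
      (\<integral>\<^sup>+q0. (\<integral>\<^sup>+v. indicator A (v(0 := q0)) \<partial>proposal_kernel Q Qbar p q0) \<partial>density m f)"
    by (rule emeasure_target_proposal_measure[OF prob _ Q Qbar A]) (simp add: sets_m)
  also have "\<dots> = (\<integral>\<^sup>+q0. \<integral>\<^sup>+q. \<integral>\<^sup>+v. indicator A (v(0 := q0)) \<partial>?V q \<partial>Qbar q0 \<partial>density m f)"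
  proof (rule nn_integral_cong)
    fix q0 assume "q0 \<in> space (density m f)"
    then have q0: "q0 \<in> space X" by (simp add: space_base)
    have "(\<lambda>v. indicator A (v(0 := q0)) :: ennreal) \<in> borel_measurable (\<Pi>\<^sub>M i\<in>{1..p}. X)"
      by (rule measurable_compose[OF ins[OF q0] borel_measurable_indicator[OF A]])
    moreover have "?V \<in> Qbar q0 \<rightarrow>\<^sub>M subprob_algebra (\<Pi>\<^sub>M i\<in>{1..p}. X)"
      using measurable_prob_algebraD[OF V]
      by (simp add: measurable_cong_sets[OF prob_algebra_kernelD(2)[OF Qbar q0] refl])
    ultimately show "(\<integral>\<^sup>+v. indicator A (v(0 := q0)) \<partial>proposal_kernel Q Qbar p q0) =
        (\<integral>\<^sup>+q. \<integral>\<^sup>+v. indicator A (v(0 := q0)) \<partial>?V q \<partial>Qbar q0)"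
      unfolding proposal_kernel_def by (rule nn_integral_bind)
  qed
  also have "\<dots> = (\<integral>\<^sup>+q0. f q0 * (\<integral>\<^sup>+q. \<integral>\<^sup>+v. indicator A (v(0 := q0)) \<partial>?V q \<partial>Qbar q0) \<partial>m)"
  proof (rule nn_integral_density)
    show "f \<in> borel_measurable m" using f by (simp add: measurable_cong_sets[OF sets_m refl])
    have "(\<lambda>q0. \<integral>\<^sup>+q. \<integral>\<^sup>+v. indicator A (v(0 := q0)) \<partial>?V q \<partial>Qbar q0) \<in> borel_measurable X"
      by (rule nn_integral_measurable_subprob_algebra2[OF _ measurable_prob_algebraD[OF Qbar]])
        (use measurable_pair_swap[OF G] in \<open>simp add: case_prod_beta'\<close>)
    then show "(\<lambda>q0. \<integral>\<^sup>+q. \<integral>\<^sup>+v. indicator A (v(0 := q0)) \<partial>?V q \<partial>Qbar q0) \<in> borel_measurable m"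
      by (simp add: measurable_cong_sets[OF sets_m refl])
  qed
  \<comment> \<open>The factor \<open>f q0\<close> moves inside so that the whole integrand is a
    single function of the pair \<open>q\<close>, \<open>q0\<close>, to which reversibility
    applies.\<close>
  also have "\<dots> = (\<integral>\<^sup>+q0. \<integral>\<^sup>+q. f q0 * (\<integral>\<^sup>+v. indicator A (v(0 := q0)) \<partial>?V q) \<partial>Qbar q0 \<partial>m)"
  proof (rule nn_integral_cong, rule nn_integral_cmult[symmetric])
    fix q0 assume "q0 \<in> space m"
    then have q0: "q0 \<in> space X" by (simp add: space_base)
    show "(\<lambda>q. \<integral>\<^sup>+v. indicator A (v(0 := q0)) \<partial>?V q) \<in> borel_measurable (Qbar q0)"
      using measurable_Pair1[OF G q0]
      by (simp add: measurable_cong_sets[OF prob_algebra_kernelD(2)[OF Qbar q0] refl])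
  qed
  also have "\<dots> = (\<integral>\<^sup>+q. \<integral>\<^sup>+q0. f q0 * (\<integral>\<^sup>+v. indicator A (v(0 := q0)) \<partial>?V q) \<partial>Q q \<partial>m)"
    using f G by (intro reversible_nn_integral[OF Q Qbar sets_m rev, symmetric])
      (simp add: case_prod_beta')
  also have "\<dots> = (\<integral>\<^sup>+q. \<integral>\<^sup>+w. f (w 0) * indicator A w \<partial>(\<Pi>\<^sub>M i\<in>{0..p}. Q q) \<partial>m)"
  proof (rule nn_integral_cong)
    fix q assume "q \<in> space m"
    then have q: "q \<in> space X" by (simp add: space_base)
    interpret prob_space "Q q" by (rule prob_algebra_kernelD(1)[OF Q q])
    interpret product_sigma_finite "\<lambda>_. Q q" by unfold_locales
    \<comment> \<open>Coordinate 0 is split off as the outer variable, so that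
      \<open>f (w 0)\<close> is constant in the inner integral over \<open>v\<close>.\<close>
    have *: "{0..p} = insert 0 {1..p}" by auto
    have "(\<lambda>w. f (w 0) * indicator A w) \<in> borel_measurable (\<Pi>\<^sub>M i\<in>{0..p}. Q q)"
      using fA by (simp add: measurable_cong_sets[OF sets_PiM_kernel[OF q] refl])
    then have "(\<integral>\<^sup>+w. f (w 0) * indicator A w \<partial>(\<Pi>\<^sub>M i\<in>{0..p}. Q q)) =
        (\<integral>\<^sup>+q0. \<integral>\<^sup>+v. f q0 * indicator A (v(0 := q0)) \<partial>?V q \<partial>Q q)"
      unfolding * by (subst product_nn_integral_insert_rev) auto
    also have "\<dots> = (\<integral>\<^sup>+q0. f q0 * (\<integral>\<^sup>+v. indicator A (v(0 := q0)) \<partial>?V q) \<partial>Q q)"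
    proof (rule nn_integral_cong, rule nn_integral_cmult)
      fix q0 assume "q0 \<in> space (Q q)"
      then have q0: "q0 \<in> space X" by (simp add: prob_algebra_kernelD(3)[OF Q q])
      show "(\<lambda>v. indicator A (v(0 := q0)) :: ennreal) \<in> borel_measurable (?V q)"
        using measurable_compose[OF ins[OF q0] borel_measurable_indicator[OF A]]
        by (simp add: measurable_cong_sets[OF sets_PiM_kernel[OF q] refl])
    qed
    finally show "(\<integral>\<^sup>+q0. f q0 * (\<integral>\<^sup>+v. indicator A (v(0 := q0)) \<partial>?V q) \<partial>Q q) =
        (\<integral>\<^sup>+w. f (w 0) * indicator A w \<partial>(\<Pi>\<^sub>M i\<in>{0..p}. Q q))" ..
  qed
  also have "\<dots> = (\<integral>\<^sup>+w. f (w 0) * indicator A w \<partial>?N)"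
    unfolding mixed_product_measure_def
    by (rule nn_integral_bind[OF fA PiM_kernel_subprob, symmetric])
  also have "\<dots> = emeasure (density ?N (\<lambda>w. f (w 0))) A"
    using f0 A
    by (intro emeasure_density[symmetric])
      (simp_all add: sets_mixed_product_measure measurable_cong_sets[OF sets_mixed_product_measure refl])
  finally show "emeasure ?M A = emeasure (density ?N (\<lambda>w. f (w 0))) A" .
qed

end

section \<open>Pushforward and quotient of densities\<close>

text \<open>Since \<open>T\<close> is an involution, \<open>f\<close> is the composite of
  \<open>f (T x)\<close> with \<open>T\<close>. The change of variables formula then applies, and
  invariance identifies the image of \<open>N\<close> with \<open>N\<close>.\<close>

lemma distr_density_invariant:
  assumes T: "T \<in> N \<rightarrow>\<^sub>M N" and inv: "distr N N T = N" and TT: "\<And>x. x \<in> space N \<Longrightarrow> T (T x) = x"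
    and f: "f \<in> borel_measurable N"
  shows "distr (density N f) N T = density N (\<lambda>x. f (T x))"
proof -
  have fT: "(\<lambda>x. f (T x)) \<in> borel_measurable N" using T f by simp
  have "density N (\<lambda>x. f (T x)) = density (distr N N T) (\<lambda>x. f (T x))" by (simp add: inv)
  also have "\<dots> = distr (density N (\<lambda>x. f (T (T x)))) N T"
    by (rule density_distr[OF fT T])
  also have "density N (\<lambda>x. f (T (T x))) = density N f"
    using T f fT by (intro density_cong) (auto simp: TT)
  finally show ?thesis ..
qed

text \<open>In the extended nonnegative reals \<open>f x * inverse (f x)\<close> equals 1 only when
  \<open>f x\<close> is neither 0 nor infinite, hence both conditions in \<open>pos\<close>.\<close>

lemma density_ratio:
  assumes [measurable]: "f \<in> borel_measurable N" "g \<in> borel_measurable N"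
    and pos: "AE x in N. 0 < f x" "AE x in N. f x \<noteq> (\<infinity> :: ennreal)"
  shows "density (density N f) (\<lambda>x. g x * inverse (f x)) = density N g"
proof -
  have "density (density N f) (\<lambda>x. g x * inverse (f x)) = density N (\<lambda>x. f x * (g x * inverse (f x)))"
    by (rule density_density_eq) measurable
  also have "\<dots> = density N g"
  proof (rule density_cong)
    show "AE x in N. f x * (g x * inverse (f x)) = g x"
      using pos
    proof eventually_elim
      case (elim x)
      have "f x * (g x * inverse (f x)) = g x * (f x / f x)"
        by (simp add: divide_ennreal_def ac_simps)
      then show ?case using elim by (simp add: ennreal_divide_self top.not_eq_extremum)
    qed
  qed measurable
  finally show ?thesis .
qed

section \<open>The Radon-Nikodym derivative of the swapped measure\<close>

theorem theorem2p11:
  fixes X \<mu> \<mu>\<^sub>0 :: "'a measure" and Q Qbar :: "'a \<Rightarrow> 'a measure" and p :: nat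
  assumes "p \<ge> 1"
    and "prob_space \<mu>" and "sets \<mu> = sets X"
    and "Q \<in> X \<rightarrow>\<^sub>M prob_algebra X"
    and "Qbar \<in> X \<rightarrow>\<^sub>M prob_algebra X"
    and "sigma_finite_measure \<mu>\<^sub>0" and "sets \<mu>\<^sub>0 = sets X"
    and "absolutely_continuous \<mu>\<^sub>0 \<mu>"
    and "AE q in \<mu>\<^sub>0. RN_deriv \<mu>\<^sub>0 \<mu> q > 0"
    and "\<mu>\<^sub>0 \<bind> (\<lambda>q. distr (Q q) (X \<Otimes>\<^sub>M X) (\<lambda>q'. (q, q'))) =
         \<mu>\<^sub>0 \<bind> (\<lambda>q'. distr (Qbar q') (X \<Otimes>\<^sub>M X) (\<lambda>q. (q, q')))"
  shows "\<forall>j\<in>{0..p}.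
    (let M = target_proposal_measure X \<mu> Q Qbar p;
         M\<^sub>j = distr M (\<Pi>\<^sub>M i\<in>{0..p}. X) (coord_swap j)
     in absolutely_continuous M M\<^sub>j \<and>
        (AE w in M. RN_deriv M M\<^sub>j w = RN_deriv \<mu>\<^sub>0 \<mu> (w j) * inverse (RN_deriv \<mu>\<^sub>0 \<mu> (w 0))))"
proof
  fix j assume "j \<in> {0..p}"
  then have j: "j \<le> p" by simp
  note Q = assms(4) and Qbar = assms(5) and sets0 = assms(7) and rev = assms(10)
  interpret \<mu>: prob_space \<mu> by fact
  interpret \<mu>0: sigma_finite_measure "\<mu>\<^sub>0" by fact
  define f where "f = RN_deriv \<mu>\<^sub>0 \<mu>"
  define M where "M = target_proposal_measure X \<mu> Q Qbar p"
  let ?N = "mixed_product_measure \<mu>\<^sub>0 Q p" and ?P = "\<Pi>\<^sub>M i\<in>{0..p}. X"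
  define Mj where "Mj = distr M ?P (coord_swap j)"
  let ?r = "\<lambda>w. f (w j) * inverse (f (w 0))"
  \<comment> \<open>A probability measure lives on a nonempty space; this excludes the degenerate
    default value of \<open>bind\<close>.\<close>
  have ne: "space X \<noteq> {}"
    using \<mu>.not_empty sets_eq_imp_space_eq[OF assms(3)] by simp
  have sets_N: "sets ?N = sets ?P"
    by (rule sets_mixed_product_measure[OF Q sets0 ne])
  have f: "f \<in> borel_measurable X"
    unfolding f_def using borel_measurable_RN_deriv[of "\<mu>\<^sub>0" \<mu>]
    by (simp add: measurable_cong_sets[OF sets0 refl])
  have dens: "density \<mu>\<^sub>0 f = \<mu>"
    unfolding f_def using assms by (intro \<mu>0.density_RN_deriv) auto
  have fi: "(\<lambda>w. f (w i)) \<in> borel_measurable ?N" if "i \<le> p" for i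
    using measurable_compose[OF measurable_component_singleton[of i "{0..p}" "\<lambda>_. X"] f] that
    by (simp add: measurable_cong_sets[OF sets_N refl])
  have marg: "distr ?N X (\<lambda>w. w 0) = \<mu>\<^sub>0"
    using mixed_product_measure_component[OF Q sets0 ne, of 0 p]
      reversible_bind_eq[OF Q Qbar sets0 ne rev] by simp
  \<comment> \<open>As coordinate 0 has law \<open>\<mu>\<^sub>0\<close> under \<open>?N\<close>,
    null sets of \<open>\<mu>\<^sub>0\<close> pull back to null sets of \<open>?N\<close>.\<close>
  have lift: "AE w in ?N. R (w 0)" if "AE q in \<mu>\<^sub>0. R q" for R
  proof (rule AE_distrD[where f="\<lambda>w. w 0" and P=R])
    have "(\<lambda>w. w 0) \<in> ?P \<rightarrow>\<^sub>M X" by (rule measurable_component_singleton) simp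
    then show "(\<lambda>w. w 0) \<in> ?N \<rightarrow>\<^sub>M X" by (simp add: measurable_cong_sets[OF sets_N refl])
    show "AE q in distr ?N X (\<lambda>w. w 0). R q" unfolding marg by (rule that)
  qed
  have pos: "AE w in ?N. 0 < f (w 0)"
    by (rule lift) (use assms(9) in \<open>simp add: f_def\<close>)
  \<comment> \<open>Finiteness of the derivative comes from sigma-finiteness of
    \<open>\<mu>\<close>.\<close>
  have fin: "AE w in ?N. f (w 0) \<noteq> \<infinity>"
    by (rule lift) (use \<mu>0.RN_deriv_finite[OF \<mu>.sigma_finite_measure_axioms assms(8)] assms(3,7)
      in \<open>simp add: f_def\<close>)
  have M: "M = density ?N (\<lambda>w. f (w 0))"
    using target_proposal_measure_density[OF Q sets0 ne Qbar rev f, of p] assms(2)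
    by (simp add: M_def dens)
  have swap: "coord_swap j \<in> ?N \<rightarrow>\<^sub>M ?N"
    using coord_swap_measurable[OF j, of X] by (simp add: measurable_cong_sets[OF sets_N sets_N])
  \<comment> \<open>Only the sigma-algebra of the target matters for \<open>distr\<close>; taking
    \<open>?N\<close> as target makes the swap a self-map of \<open>?N\<close>.\<close>
  have "Mj = distr M ?N (coord_swap j)"
    unfolding Mj_def by (rule distr_cong) (simp_all add: sets_N)
  also have "\<dots> = density ?N (\<lambda>w. f (coord_swap j w 0))"
    unfolding M
  proof (rule distr_density_invariant[OF swap])
    show "distr ?N ?N (coord_swap j) = ?N"
      using mixed_product_measure_coord_swap[OF Q sets0 ne j]
        distr_cong[OF refl sets_N, of ?N "coord_swap j" "coord_swap j"] by simp
  qed (auto simp: coord_swap_def fi)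
  \<comment> \<open>For \<open>j = 0\<close> the second update in \<open>coord_swap\<close>
    overwrites the first, hence the case split.\<close>
  also have "\<dots> = density ?N (\<lambda>w. f (w j))" by (cases "j = 0") (simp_all add: coord_swap_def)
  also have "\<dots> = density M ?r"
    unfolding M using density_ratio[OF fi fi pos fin] j by simp
  finally have Mj: "density M ?r = Mj" ..
  have r: "?r \<in> borel_measurable M"
    using fi[of 0] fi[OF j] by (simp add: M)
  \<comment> \<open>This supplies the sigma-finiteness of \<open>M\<close> on which uniqueness of
    the derivative rests.\<close>
  have "prob_space M"
    unfolding M_def using target_proposal_measure_in_prob_algebra[OF assms(2,3) Q Qbar]
    by (simp add: space_prob_algebra)
  then interpret M: prob_space M .
  have "absolutely_continuous M Mj"
    unfolding Mj[symmetric] using r by (rule absolutely_continuousI_density)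
  moreover have "AE w in M. RN_deriv M Mj w = ?r w"
    using M.RN_deriv_unique[OF r Mj] by eventually_elim simp
  ultimately show "let M = target_proposal_measure X \<mu> Q Qbar p;
         M\<^sub>j = distr M (\<Pi>\<^sub>M i\<in>{0..p}. X) (coord_swap j)
     in absolutely_continuous M M\<^sub>j \<and>
        (AE w in M. RN_deriv M M\<^sub>j w = RN_deriv \<mu>\<^sub>0 \<mu> (w j) * inverse (RN_deriv \<mu>\<^sub>0 \<mu> (w 0)))"
    unfolding Let_def M_def Mj_def f_def by (rule conjI)
qed

end
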